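(* Let $N$ be a nil ring. Then there is no surjective ring homomorphism from the polynomial ring $N[x]$ onto a simple right primitive ring.
   Context: Rings are associative but need not have an identity, and ring homomorphisms are not required to preserve identities. $N[x]$ is the ring of polynomials in one (central) indeterminate $x$ with coefficients in $N$. A ring is nil if each of its elements is nilpotent. A ring $S$ is simple if $S^2\neq 0$ and its only two-sided ideals are $0$ and $S$. For a ring $S$, a right ideal $Q$ of $S$ is modular if there is $b\in S$ with $a-ba\in Q$ for every $a\in S$. A modular maximal right ideal is a proper modular right ideal of $S$ that is maximal among the proper right ideals of $S$. A two-sided ideal $P$ of $S$ is right primitive in $S$ if there is a modular maximal right ideal $Q$ of $S$ such that $P$ is the largest two-sided ideal of $S$ contained in $Q$. The ring $S$ is right primitive if $0$ is a right primitive ideal of $S$. *)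

theory Defs
  imports Main "HOL-Library.Poly_Mapping"
begin

(* The type class ring demands neither commutativity nor an identity, so a ring is
   represented by a type of this class, and its ideals by sets over that type. *)

(* N[x] is the monoid ring of the additive monoid nat over N: Poly_Mapping.lookup p i is the
   coefficient of x^i in p.  The type 'a poly is not usable here, since its multiplication
   requires commutative coefficients.  When N has no identity, the indeterminate x itself is
   not an element of N[x]. *)
type_synonym 'a polynomial_ring = "nat \<Rightarrow>\<^sub>0 'a"

lemma lookup_times_polynomial_ring:
  fixes p q :: "'a::ring polynomial_ring"
  shows "Poly_Mapping.lookup (p * q) k =
    (\<Sum>i\<le>k. Poly_Mapping.lookup p i * Poly_Mapping.lookup q (k - i))"
proof -
  have inner: "(\<Sum>j. b j when k = i + j) = (b (k - i) when i \<le> k)" for b :: "nat \<Rightarrow> 'a" and i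
  proof -
    have "(\<Sum>j. b j when k = i + j) = (\<Sum>j\<in>{k - i}. b j when k = i + j)"
      by (rule Sum_any.expand_superset) (auto simp: when_def)
    then show ?thesis
      by (auto simp: when_def)
  qed
  have "Poly_Mapping.lookup (p * q) k =
      (\<Sum>i. Poly_Mapping.lookup p i * (Poly_Mapping.lookup q (k - i) when i \<le> k))"
    by (simp add: times_poly_mapping.rep_eq prod_fun_def inner)
  also have "\<dots> =
      (\<Sum>i\<in>{..k}. Poly_Mapping.lookup p i * (Poly_Mapping.lookup q (k - i) when i \<le> k))"
    by (rule Sum_any.expand_superset) (auto simp: when_def split: if_splits)
  finally show ?thesis
    by simp
qed

definition ring_homomorphism :: "('a::ring \<Rightarrow> 'b::ring) \<Rightarrow> bool" where
  "ring_homomorphism f \<longleftrightarrow>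
    (\<forall>x y. f (x + y) = f x + f y) \<and> (\<forall>x y. f (x * y) = f x * f y)"

(* The iterate on the right is the power a^(n+1); the operator ^ is not available, as it
   needs an identity. *)
definition nilpotent :: "'a::ring \<Rightarrow> bool" where
  "nilpotent a \<longleftrightarrow> (\<exists>n. ((*) a ^^ n) a = 0)"

definition nil_ring :: "'a::ring itself \<Rightarrow> bool" where
  "nil_ring _ \<longleftrightarrow> (\<forall>a::'a. nilpotent a)"

definition additive_subgroup :: "'a::ring set \<Rightarrow> bool" where
  "additive_subgroup I \<longleftrightarrow> 0 \<in> I \<and> (\<forall>a\<in>I. \<forall>b\<in>I. a + b \<in> I) \<and> (\<forall>a\<in>I. - a \<in> I)"

definition right_ideal :: "'a::ring set \<Rightarrow> bool" where
  "right_ideal I \<longleftrightarrow> additive_subgroup I \<and> (\<forall>a\<in>I. \<forall>s. a * s \<in> I)"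

definition two_sided_ideal :: "'a::ring set \<Rightarrow> bool" where
  "two_sided_ideal I \<longleftrightarrow>
    additive_subgroup I \<and> (\<forall>a\<in>I. \<forall>s. a * s \<in> I \<and> s * a \<in> I)"

(* S^2, the additive subgroup generated by all products *)
definition ring_square :: "'a::ring itself \<Rightarrow> 'a set" where
  "ring_square _ = {\<Sum>i<n. f i * g i | (n::nat) (f :: nat \<Rightarrow> 'a) g. True}"

definition simple_ring :: "'a::ring itself \<Rightarrow> bool" where
  "simple_ring S \<longleftrightarrow>
    ring_square S \<noteq> {0} \<and> (\<forall>I :: 'a set. two_sided_ideal I \<longrightarrow> I = {0} \<or> I = UNIV)"

definition modular_right_ideal :: "'a::ring set \<Rightarrow> bool" where
  "modular_right_ideal Q \<longleftrightarrow> right_ideal Q \<and> (\<exists>b. \<forall>a. a - b * a \<in> Q)"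

definition modular_maximal_right_ideal :: "'a::ring set \<Rightarrow> bool" where
  "modular_maximal_right_ideal Q \<longleftrightarrow> modular_right_ideal Q \<and> Q \<noteq> UNIV \<and>
    (\<forall>J. right_ideal J \<and> J \<noteq> UNIV \<and> Q \<subseteq> J \<longrightarrow> J = Q)"

definition largest_two_sided_ideal_in :: "'a::ring set \<Rightarrow> 'a set \<Rightarrow> bool" where
  "largest_two_sided_ideal_in P Q \<longleftrightarrow> two_sided_ideal P \<and> P \<subseteq> Q \<and>
    (\<forall>I. two_sided_ideal I \<and> I \<subseteq> Q \<longrightarrow> I \<subseteq> P)"

definition right_primitive_ideal :: "'a::ring set \<Rightarrow> bool" where
  "right_primitive_ideal P \<longleftrightarrow>
    (\<exists>Q. modular_maximal_right_ideal Q \<and> largest_two_sided_ideal_in P Q)"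

definition right_primitive_ring :: "'a::ring itself \<Rightarrow> bool" where
  "right_primitive_ring _ \<longleftrightarrow> right_primitive_ideal ({0} :: 'a set)"

end

theory Submission
  imports Defs
begin

text \<open>
  Let \<open>S\<close> be a simple ring that is the image of \<open>N[x]\<close>, with \<open>N\<close> nil.  It is shown that \<open>S\<close> has no
  proper modular right ideal at all, that is, \<open>S\<close> is a Jacobson radical ring; a right primitive
  ring has one.

  As \<open>S\<close> is simple, its centroid (the additive maps that commute with left and right
  multiplication) is a field, and multiplication by \<open>x\<close> induces an element \<open>T\<close> of it.  Replacing
  \<open>N\<close> by its image, a nil subring of \<open>S\<close>, we have \<open>S = N[T]\<close>.  If \<open>T = 0\<close>, then \<open>S\<close> is nil.
  Otherwise \<open>T\<close> is invertible, and writing \<open>T\<^sup>-\<^sup>1 a\<close>, for \<open>a\<close> in \<open>N\<close>, as a polynomial in \<open>T\<close> gives a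
  nontrivial relation for \<open>T\<close> over \<open>N\<close>.  By Martindale's argument (\<open>centroid_extension\<close>) a relation
  of least degree \<open>n\<close> becomes a monic equation of degree \<open>n\<close> for \<open>T\<close> over the field \<open>C\<close> of those
  centroid elements that map some nonzero element of \<open>N\<close> into \<open>N\<close>.  With \<open>R\<close> the central closure
  of \<open>N\<close> inside \<open>S\<close>, the ring \<open>S\<close> is the direct sum of the \<open>T\<^sup>i R\<close> for \<open>i < n\<close>, so by Nakayama's
  lemma it is enough that every \<open>s\<close> in \<open>R\<close> lies in \<open>(1 - s) R\<close>.

  This is \<open>central_closure_quasi_regular\<close>, the heart of the proof.  Let \<open>Q = (1 - s) S\<close>, so that
  \<open>a \<equiv> s a\<close> modulo \<open>Q\<close>, and write \<open>s\<close> as a polynomial in \<open>T\<close> over \<open>N\<close> without constant term, of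
  degree \<open>d\<close>.  In any polynomial the lowest term \<open>T\<^sup>m a\<close> may be replaced by \<open>s T\<^sup>m a\<close>, whose terms have
  degrees from \<open>m + 1\<close> to \<open>m + d\<close>.  Hence \<open>s\<close> is congruent to polynomials with only \<open>d\<close>
  consecutive terms, at the cost of a power \<open>T\<^sup>m\<close> in front (\<open>polys_width_reduction\<close>).  Since \<open>S\<close> is
  simple, it is also spanned by any nonzero ideal of \<open>N\<close>, in particular by the elements \<open>a\<close> for which
  \<open>a, T a, \<dots>, T\<^sup>d\<^sup>-\<^sup>1 a\<close> are polynomials of degree less than \<open>n\<close>; starting from such coefficients we
  get \<open>s \<equiv> T\<^sup>m (e\<^sub>0 + T e\<^sub>1 + \<dots> + T\<^sup>n\<^sup>-\<^sup>1 e\<^sub>n\<^sub>-\<^sub>1)\<close> with all \<open>e\<^sub>i\<close> in \<open>N\<close>.  Expanding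
  \<open>T\<^sup>-\<^sup>m = c\<^sub>0 + T c\<^sub>1 + \<dots>\<close> over \<open>C\<close> and comparing coefficients gives \<open>c\<^sub>i s \<equiv> e\<^sub>i\<close>.  A nonzero scalar
  \<open>c\<^sub>i\<close> thus acts on the class of \<open>s\<close>, a left unit modulo \<open>Q\<close>, like a nilpotent element, which forces
  \<open>s\<close> into \<open>Q\<close>; comparing coefficients once more puts \<open>s\<close> into \<open>(1 - s) R\<close>.
\<close>

section \<open>Simple rings and their centroid\<close>

lemma simple_ring_ideal_UNIV:
  assumes "simple_ring TYPE('s::ring)" "two_sided_ideal (I :: 's set)" "x \<in> I" "x \<noteq> 0"
  shows "I = UNIV"
  using assms unfolding simple_ring_def by blast

lemma simple_ring_product_nonzero:
  assumes "simple_ring TYPE('s::ring)"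
  shows "\<exists>x y :: 's. x * y \<noteq> 0"
proof (rule ccontr)
  assume "\<not> ?thesis"
  then have "ring_square TYPE('s) = {0}"
    by (auto simp: ring_square_def)
  with assms show False
    by (simp add: simple_ring_def)
qed

lemma simple_ring_left_annihilator:
  assumes S: "simple_ring TYPE('s::ring)" and x: "\<And>y. x * y = (0::'s)"
  shows "x = 0"
proof (rule ccontr)
  assume "x \<noteq> 0"
  have "two_sided_ideal {z::'s. \<forall>y. z * y = 0}"
    by (auto simp: two_sided_ideal_def additive_subgroup_def distrib_right mult.assoc)
  from simple_ring_ideal_UNIV[OF S this _ \<open>x \<noteq> 0\<close>] x have "\<forall>z y :: 's. z * y = 0"
    by auto
  with simple_ring_product_nonzero[OF S] show False by blast
qed

lemma simple_ring_right_annihilator: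
  assumes S: "simple_ring TYPE('s::ring)" and x: "\<And>y. y * x = (0::'s)"
  shows "x = 0"
proof (rule ccontr)
  assume "x \<noteq> 0"
  have "two_sided_ideal {z::'s. \<forall>y. y * z = 0}"
    by (auto simp: two_sided_ideal_def additive_subgroup_def distrib_left mult.assoc[symmetric])
  from simple_ring_ideal_UNIV[OF S this _ \<open>x \<noteq> 0\<close>] x have "\<forall>z y :: 's. y * z = 0"
    by auto
  with simple_ring_product_nonzero[OF S] show False by blast
qed

lemma simple_ring_prime:
  assumes S: "simple_ring TYPE('s::ring)" and ab: "\<And>r. a * r * b = (0::'s)" and b: "b \<noteq> 0"
  shows "a = 0"
proof (rule ccontr)
  assume "a \<noteq> 0"
  have "two_sided_ideal {z::'s. \<forall>r. z * r * b = 0}"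
    by (auto simp: two_sided_ideal_def additive_subgroup_def distrib_right mult.assoc)
       (metis mult.assoc)
  from simple_ring_ideal_UNIV[OF S this _ \<open>a \<noteq> 0\<close>] ab have "\<forall>z r :: 's. z * (r * b) = 0"
    by (auto simp: mult.assoc)
  then have "\<And>r. r * b = 0"
    using simple_ring_right_annihilator[OF S] by blast
  then have "b = 0"
    using simple_ring_right_annihilator[OF S] by blast
  with b show False ..
qed

definition centroid :: "('s::ring \<Rightarrow> 's) set" where
  "centroid = {g. (\<forall>x y. g (x + y) = g x + g y) \<and> (\<forall>x y. g (x * y) = g x * y) \<and>
    (\<forall>x y. g (x * y) = x * g y)}"

lemma centroid_add: "g \<in> centroid \<Longrightarrow> g (x + y) = g x + g y"
  unfolding centroid_def by blast

lemma centroid_mult_left: "g \<in> centroid \<Longrightarrow> g x * y = g (x * y)"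
  unfolding centroid_def by fastforce

lemma centroid_mult_right: "g \<in> centroid \<Longrightarrow> x * g y = g (x * y)"
  unfolding centroid_def mem_Collect_eq by metis

lemma centroid_zero: "g \<in> centroid \<Longrightarrow> g 0 = 0"
  using centroid_add[of g 0 0] by simp

lemma centroid_minus: "g \<in> centroid \<Longrightarrow> g (- x) = - g x"
  using centroid_add[of g x "- x"] by (simp add: centroid_zero eq_neg_iff_add_eq_0 add.commute)

lemma centroid_diff: "g \<in> centroid \<Longrightarrow> g (x - y) = g x - g y"
  using centroid_add[of g x "- y"] by (simp add: centroid_minus)

lemma centroid_sum: "g \<in> centroid \<Longrightarrow> g (\<Sum>i\<in>I. f i) = (\<Sum>i\<in>I. g (f i))"
  by (induction I rule: infinite_finite_induct) (simp_all add: centroid_add centroid_zero)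

lemma id_in_centroid: "(\<lambda>x. x) \<in> centroid"
  by (simp add: centroid_def)

lemma centroidI:
  assumes "\<And>x y. g (x + y) = g x + g y" "\<And>x y. g (x * y) = g x * y" "\<And>x y. g (x * y) = x * g y"
  shows "g \<in> centroid"
  unfolding centroid_def using assms by blast

lemma centroid_compose: "g \<in> centroid \<Longrightarrow> h \<in> centroid \<Longrightarrow> (\<lambda>x. g (h x)) \<in> centroid"
  by (rule centroidI) (simp_all add: centroid_add centroid_mult_left centroid_mult_right)

lemma centroid_difference: "g \<in> centroid \<Longrightarrow> h \<in> centroid \<Longrightarrow> (\<lambda>x. g x - h x) \<in> centroid"
  by (rule centroidI) (simp_all add: centroid_add centroid_mult_left centroid_mult_right
      left_diff_distrib right_diff_distrib)

lemma centroid_funpow: "g \<in> centroid \<Longrightarrow> g ^^ i \<in> centroid"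
  by (induction i) (auto simp: id_def comp_def intro: id_in_centroid centroid_compose)

lemma centroid_sum_closed:
  "(\<And>i. i \<in> I \<Longrightarrow> f i \<in> centroid) \<Longrightarrow> (\<lambda>x. \<Sum>i\<in>I. f i x) \<in> centroid"
  by (rule centroidI) (simp_all add: centroid_add centroid_mult_left centroid_mult_right
      sum.distrib sum_distrib_left sum_distrib_right)

text \<open>
  The kernel of a centroid element is a two-sided ideal; so is its image in the next lemma.  Together
  they make the centroid of a simple ring a division ring.
\<close>
lemma centroid_kernel:
  assumes S: "simple_ring TYPE('s::ring)" and g: "g \<in> centroid" and x: "g x = 0" "x \<noteq> (0::'s)"
  shows "g y = 0"
proof -
  have "two_sided_ideal {z. g z = 0}"
    using g by (auto simp: two_sided_ideal_def additive_subgroup_def centroid_zero centroid_add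
        centroid_minus centroid_mult_left[OF g, symmetric])
      (simp add: centroid_mult_left[OF g] centroid_mult_right[OF g, symmetric])
  from simple_ring_ideal_UNIV[OF S this, of x] x show ?thesis by auto
qed

lemma centroid_bij:
  assumes S: "simple_ring TYPE('s::ring)" and g: "g \<in> centroid" and y: "g y \<noteq> (0::'s)"
  shows "bij g"
proof (rule bijI)
  show "inj g"
  proof (rule injI)
    fix x x' assume "g x = g x'"
    then have "g (x - x') = 0"
      using g by (simp add: centroid_diff)
    then have "x - x' = 0"
      using centroid_kernel[OF S g] y by blast
    then show "x = x'" by simp
  qed
  have "two_sided_ideal (range g)"
    unfolding two_sided_ideal_def additive_subgroup_def
    by (auto simp: centroid_mult_left[OF g] centroid_mult_right[OF g]
        centroid_add[OF g, symmetric] centroid_minus[OF g, symmetric]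
        intro: range_eqI[of _ g 0] centroid_zero[OF g, symmetric])
  from simple_ring_ideal_UNIV[OF S this _ y] show "surj g" by auto
qed

lemma centroid_inv:
  assumes g: "g \<in> centroid" and bij: "bij (g :: 's::ring \<Rightarrow> 's)"
  shows "inv g \<in> centroid"
proof -
  have gi: "g (inv g x) = x" for x
    using bij by (simp add: bij_is_surj surj_f_inv_f)
  have ig: "inv g (g x) = x" for x
    using bij by (simp add: bij_is_inj)
  have eqI: "inv g x = y" if "x = g y" for x y
    using that ig by simp
  show ?thesis
    by (intro centroidI; rule eqI)
      (simp_all add: gi centroid_add[OF g] centroid_mult_left[OF g, of "inv g x" for x, symmetric]
        centroid_mult_right[OF g, of _ "inv g y" for y, symmetric])
qed

text \<open>
  Martindale's construction of the quotient \<open>h / g\<close> as a scalar: \<open>\<phi>\<close> should send \<open>\<Sum> x g y\<close> to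
  \<open>\<Sum> x h y\<close>.  Characterising \<open>z = \<phi> s\<close> by \<open>z r g = s r h\<close> for all \<open>r\<close> avoids these sums: such \<open>z\<close>
  is unique because a simple ring is prime, and the elements \<open>s\<close> that admit one form a two-sided
  ideal containing \<open>g\<close>.
\<close>
lemma centroid_extension:
  assumes S: "simple_ring TYPE('s::ring)" and g: "g \<noteq> (0::'s)"
    and gh: "\<And>r. g * r * h = h * r * g"
  shows "\<exists>\<phi>\<in>centroid. \<phi> g = h"
proof -
  let ?I = "{s. \<exists>z. \<forall>r. z * r * g = s * r * h}"
  have unique: "z = z'" if "\<And>r. z * r * g = z' * r * g" for z z'
    using simple_ring_prime[OF S _ g, of "z - z'"] that by (simp add: left_diff_distrib)
  have "two_sided_ideal ?I"
    unfolding two_sided_ideal_def additive_subgroup_def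
  proof (intro conjI ballI allI)
    show "0 \<in> ?I" by (auto intro: exI[of _ 0])
    fix x assume "x \<in> ?I"
    then obtain u where u: "\<And>r. u * r * g = x * r * h" by auto
    have "\<forall>r. (- u) * r * g = (- x) * r * h" by (simp add: u)
    then show "- x \<in> ?I" by blast
    fix y
    have "\<forall>r. (u * y) * r * g = (x * y) * r * h"
      using u[of "y * r" for r] by (simp add: mult.assoc)
    then show "x * y \<in> ?I" by blast
    have "\<forall>r. (y * u) * r * g = (y * x) * r * h"
      using u by (simp add: mult.assoc)
    then show "y * x \<in> ?I" by blast
  next
    fix x y assume "x \<in> ?I" "y \<in> ?I"
    then obtain u v where "\<And>r. u * r * g = x * r * h" "\<And>r. v * r * g = y * r * h" by auto
    then have "\<forall>r. (u + v) * r * g = (x + y) * r * h" by (simp add: distrib_right)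
    then show "x + y \<in> ?I" by blast
  qed
  moreover have "g \<in> ?I" using gh by auto
  ultimately have "?I = UNIV" using simple_ring_ideal_UNIV[OF S] g by blast
  then have "\<forall>s. \<exists>z. \<forall>r. z * r * g = s * r * h" by blast
  then obtain \<phi> where \<phi>: "\<And>s r. \<phi> s * r * g = s * r * h"
    by metis
  have "\<phi> \<in> centroid"
  proof (rule centroidI)
    fix x y
    show "\<phi> (x + y) = \<phi> x + \<phi> y"
      by (rule unique) (simp add: \<phi> distrib_right)
    show "\<phi> (x * y) = \<phi> x * y"
      by (rule unique) (use \<phi>[of x "y * r" for r] \<phi>[of "x * y"] in \<open>simp add: mult.assoc\<close>)
    show "\<phi> (x * y) = x * \<phi> y"
      by (rule unique) (use \<phi>[of y] \<phi>[of "x * y"] in \<open>simp add: mult.assoc\<close>)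
  qed
  moreover have "\<phi> g = h"
    by (rule unique) (simp add: \<phi> gh)
  ultimately show ?thesis by blast
qed

section \<open>Polynomials in a centroid element\<close>

text \<open>
  The part of \<open>A[T]\<close> of degree less than \<open>k\<close>; bounds on \<open>k\<close> are what the main argument controls.
\<close>
definition polys :: "('s::ring \<Rightarrow> 's) \<Rightarrow> 's set \<Rightarrow> nat \<Rightarrow> 's set" where
  "polys T A k = {\<Sum>i<k. (T ^^ i) (a i) | a. \<forall>i. a i \<in> A}"

lemma polysI: "(\<And>i. i < k \<Longrightarrow> a i \<in> A) \<Longrightarrow> 0 \<in> A \<Longrightarrow> (\<Sum>i<k. (T ^^ i) (a i)) \<in> polys T A k"
  unfolding polys_def
  by (rule CollectI, rule exI[of _ "\<lambda>i. if i < k then a i else 0"]) auto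

lemma polysE:
  assumes "x \<in> polys T A k"
  obtains a where "\<And>i. a i \<in> A" "x = (\<Sum>i<k. (T ^^ i) (a i))"
  using assms unfolding polys_def by blast

lemma additive_subgroup_diff: "additive_subgroup A \<Longrightarrow> x \<in> A \<Longrightarrow> y \<in> A \<Longrightarrow> x - y \<in> A"
  unfolding additive_subgroup_def by (metis add_uminus_conv_diff)

lemma additive_subgroup_sum:
  "additive_subgroup A \<Longrightarrow> (\<And>i. i \<in> I \<Longrightarrow> f i \<in> A) \<Longrightarrow> (\<Sum>i\<in>I. f i) \<in> A"
  by (induction I rule: infinite_finite_induct) (auto simp: additive_subgroup_def)

lemma polys_subgroup:
  assumes T: "T \<in> centroid" and A: "additive_subgroup A"
  shows "additive_subgroup (polys T A k)"
  unfolding additive_subgroup_def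
proof (intro conjI ballI)
  note P = centroid_funpow[OF T]
  show "0 \<in> polys T A k"
    using polysI[of k "\<lambda>i. 0" A T] A centroid_zero[OF P] by (simp add: additive_subgroup_def)
  fix x assume "x \<in> polys T A k"
  then obtain a where a: "\<And>i. a i \<in> A" "x = (\<Sum>i<k. (T ^^ i) (a i))" by (rule polysE) blast
  show "- x \<in> polys T A k"
    using polysI[of k "\<lambda>i. - a i" A T] A a centroid_minus[OF P]
    by (simp add: additive_subgroup_def sum_negf)
  fix y assume "y \<in> polys T A k"
  then obtain b where b: "\<And>i. b i \<in> A" "y = (\<Sum>i<k. (T ^^ i) (b i))" by (rule polysE) blast
  show "x + y \<in> polys T A k"
    using polysI[of k "\<lambda>i. a i + b i" A T] A a b centroid_add[OF P]
    by (simp add: additive_subgroup_def sum.distrib)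
qed

lemma polys_mono:
  assumes T: "T \<in> centroid" and A: "0 \<in> A" and k: "k \<le> k'" and x: "x \<in> polys T A k"
  shows "x \<in> polys T A k'"
proof -
  obtain a where a: "\<And>i. a i \<in> A" "x = (\<Sum>i<k. (T ^^ i) (a i))" using x by (rule polysE) blast
  have "(\<Sum>i<k'. (T ^^ i) (if i < k then a i else 0)) = (\<Sum>i<k. (T ^^ i) (a i))"
    by (rule sum.mono_neutral_cong_right)
      (use k in \<open>auto simp: centroid_zero[OF centroid_funpow[OF T]]\<close>)
  moreover have "(\<Sum>i<k'. (T ^^ i) (if i < k then a i else 0)) \<in> polys T A k'"
    by (rule polysI) (use a A in auto)
  ultimately show ?thesis by (simp add: a)
qed

lemma polys_const:
  assumes "T \<in> centroid" "0 \<in> A" "a \<in> A" "0 < k"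
  shows "a \<in> polys T A k"
proof -
  have "(\<Sum>i<Suc 0. (T ^^ i) a) \<in> polys T A (Suc 0)"
    by (rule polysI) (use assms in auto)
  then show ?thesis using polys_mono[of T A "Suc 0" k a] assms by simp
qed

lemma polys_apply:
  assumes T: "T \<in> centroid" and A: "0 \<in> A" and x: "x \<in> polys T A k"
  shows "T x \<in> polys T A (Suc k)"
proof -
  obtain a where a: "\<And>i. a i \<in> A" "x = (\<Sum>i<k. (T ^^ i) (a i))" using x by (rule polysE) blast
  have "(\<Sum>i<Suc k. (T ^^ i) (case i of 0 \<Rightarrow> 0 | Suc j \<Rightarrow> a j)) = T x"
    by (simp add: sum.lessThan_Suc_shift a centroid_sum[OF T] del: sum.lessThan_Suc)
  moreover have "(\<Sum>i<Suc k. (T ^^ i) (case i of 0 \<Rightarrow> 0 | Suc j \<Rightarrow> a j)) \<in> polys T A (Suc k)"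
    by (rule polysI) (use a A in \<open>auto split: nat.split\<close>)
  ultimately show ?thesis by simp
qed

lemma polys_mult_right:
  assumes T: "T \<in> centroid" and x: "x \<in> polys T A k"
    and r: "\<And>a. a \<in> A \<Longrightarrow> a * r \<in> A'" and A': "0 \<in> A'"
  shows "x * r \<in> polys T A' k"
proof -
  obtain a where a: "\<And>i. a i \<in> A" "x = (\<Sum>i<k. (T ^^ i) (a i))" using x by (rule polysE) blast
  have "x * r = (\<Sum>i<k. (T ^^ i) (a i * r))"
    by (simp add: a sum_distrib_right centroid_mult_left[OF centroid_funpow[OF T]])
  then show ?thesis using polysI[of k "\<lambda>i. a i * r" A' T] r a A' by simp
qed

lemma polys_mult_left:
  assumes T: "T \<in> centroid" and x: "x \<in> polys T A k"
    and r: "\<And>a. a \<in> A \<Longrightarrow> r * a \<in> A'" and A': "0 \<in> A'"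
  shows "r * x \<in> polys T A' k"
proof -
  obtain a where a: "\<And>i. a i \<in> A" "x = (\<Sum>i<k. (T ^^ i) (a i))" using x by (rule polysE) blast
  have "r * x = (\<Sum>i<k. (T ^^ i) (r * a i))"
    by (simp add: a sum_distrib_left centroid_mult_right[OF centroid_funpow[OF T]])
  then show ?thesis using polysI[of k "\<lambda>i. r * a i" A' T] r a A' by simp
qed

lemma polys_Suc_split:
  assumes T: "T \<in> centroid" and x: "x \<in> polys T A (Suc k)"
  obtains a x' where "a \<in> A" "x' \<in> polys T A k" "x = a + T x'"
proof -
  obtain a where a: "\<And>i. a i \<in> A" "x = (\<Sum>i<Suc k. (T ^^ i) (a i))"
    using x by (rule polysE) blast
  have "x = a 0 + T (\<Sum>i<k. (T ^^ i) (a (Suc i)))"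
    unfolding a(2) sum.lessThan_Suc_shift by (simp add: centroid_sum[OF T])
  moreover have "(\<Sum>i<k. (T ^^ i) (a (Suc i))) \<in> polys T A k"
    unfolding polys_def using a(1) by (intro CollectI exI[of _ "\<lambda>i. a (Suc i)"]) simp
  ultimately show thesis using a(1)[of 0] that by blast
qed

section \<open>Quasi-regular rings and Nakayama's lemma\<close>

text \<open>
  Nakayama's lemma for the module spanned by \<open>w 0, \<dots>, w (n - 1)\<close> modulo \<open>Q\<close>.  Quasi-regularity of
  \<open>A\<close> allows one to solve the last congruence for \<open>w n\<close>, and substituting the solution into the
  others lowers the number of generators.
\<close>
lemma nakayama:
  assumes Q: "right_ideal (Q :: 's::ring set)" and A: "additive_subgroup A"
    and mult: "\<And>a b. a \<in> A \<Longrightarrow> b \<in> A \<Longrightarrow> a * b \<in> A"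
    and qr: "\<And>a. a \<in> A \<Longrightarrow> \<exists>y\<in>A. a = y - a * y"
  shows "(\<And>i. i < (n::nat) \<Longrightarrow> \<exists>a. (\<forall>j. a j \<in> A) \<and> w i - (\<Sum>j<n. w j * a j) \<in> Q)
    \<Longrightarrow> i < n \<Longrightarrow> w i \<in> Q"
proof (induction n arbitrary: i)
  case 0
  then show ?case by simp
next
  case (Suc n)
  have Qsub: "additive_subgroup Q" and Qr: "\<And>q r. q \<in> Q \<Longrightarrow> q * r \<in> Q"
    using Q by (auto simp: right_ideal_def)
  have Qadd: "\<And>x y. x \<in> Q \<Longrightarrow> y \<in> Q \<Longrightarrow> x + y \<in> Q"
    using Qsub by (simp add: additive_subgroup_def)
  have Aadd: "\<And>x y. x \<in> A \<Longrightarrow> y \<in> A \<Longrightarrow> x + y \<in> A"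
    using A by (simp add: additive_subgroup_def)
  obtain a where aA: "\<And>j. a j \<in> A" and a: "w n - (\<Sum>j<Suc n. w j * a j) \<in> Q"
    using Suc.prems(1)[of n] by auto
  obtain y where yA: "y \<in> A" and y: "a n = y - a n * y" using qr aA by blast
  \<comment> \<open>Formally \<open>1 + y\<close> inverts \<open>1 - a n\<close>, so \<open>w n (1 - a n) \<equiv> \<Sum> w j a j\<close> is solved by multiplying
    with \<open>1 + y\<close> from the right.\<close>
  define c where "c j = a j + a j * y" for j
  have cA: "c j \<in> A" for j using aA yA mult Aadd by (simp add: c_def)
  define q where "q = w n - (\<Sum>j<Suc n. w j * a j)"
  have wn: "w n - (\<Sum>j<n. w j * c j) = q + q * y"
  proof -
    have q1: "q = w n - w n * a n - (\<Sum>j<n. w j * a j)" by (simp add: q_def)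
    have cancel: "a n + a n * y - y = 0" using y by (simp add: algebra_simps)
    have "q + q * y = w n - w n * (a n + a n * y - y) - (\<Sum>j<n. w j * c j)"
      by (simp add: q1 c_def algebra_simps sum.distrib sum_distrib_right)
    then show ?thesis by (simp add: cancel)
  qed
  have "q \<in> Q" using a by (simp only: q_def)
  then have wnQ: "w n - (\<Sum>j<n. w j * c j) \<in> Q"
    unfolding wn by (intro Qadd Qr)
  have small: "w j \<in> Q" if "j < n" for j
  proof (rule Suc.IH[OF _ that])
    fix j assume "j < n"
    then obtain b where bA: "\<And>j. b j \<in> A" and b: "w j - (\<Sum>l<Suc n. w l * b l) \<in> Q"
      using Suc.prems(1)[of j] by auto
    define e where "e l = b l + c l * b n" for l
    have eA: "e l \<in> A" for l using bA cA mult Aadd by (simp add: e_def)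
    have "w j - (\<Sum>l<n. w l * e l) =
      (w j - (\<Sum>l<Suc n. w l * b l)) + (w n - (\<Sum>j<n. w j * c j)) * b n"
      by (simp add: e_def algebra_simps sum.distrib sum_distrib_right)
    also have "\<dots> \<in> Q" using b wnQ Qr Qadd by blast
    finally show "\<exists>a. (\<forall>j. a j \<in> A) \<and> w j - (\<Sum>l<n. w l * a l) \<in> Q" using eA by blast
  qed
  have "(\<Sum>j<n. w j * c j) \<in> Q" using small Qr by (auto intro: additive_subgroup_sum[OF Qsub])
  from Qadd[OF wnQ this] have "w n \<in> Q" by simp
  with small Suc.prems(2) show ?case by (auto simp: less_Suc_eq)
qed

section \<open>Simple rings generated by a nil subring and a centroid element\<close>

locale nil_generated =
  fixes N :: "'s::ring set" and T :: "'s \<Rightarrow> 's"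
  assumes simple: "simple_ring TYPE('s)"
    and N_group: "additive_subgroup N"
    and N_mult: "\<And>a b. a \<in> N \<Longrightarrow> b \<in> N \<Longrightarrow> a * b \<in> N"
    and N_nil: "\<And>a. a \<in> N \<Longrightarrow> nilpotent a"
    and T: "T \<in> centroid"
    and T_nonzero: "\<exists>s. T s \<noteq> 0"
    and span: "\<And>s. \<exists>k. s \<in> polys T N k"
begin

lemma zero_in_N: "0 \<in> N" and N_add: "a \<in> N \<Longrightarrow> b \<in> N \<Longrightarrow> a + b \<in> N"
  using N_group by (simp_all add: additive_subgroup_def)

lemmas N_diff = additive_subgroup_diff[OF N_group]
lemmas Tpow = centroid_funpow[OF T]

lemma bij_T: "bij T"
  using T_nonzero centroid_bij[OF simple T] by blast

lemma T_inv: "T (inv T x) = x" and inv_T: "inv T (T x) = x"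
  using bij_T by (simp_all add: bij_is_surj surj_f_inv_f bij_is_inj)

lemma inv_T_centroid: "inv T \<in> centroid"
  using centroid_inv[OF T bij_T] .

lemma inv_T_funpow: "(inv T ^^ m) ((T ^^ m) x) = x"
proof (induction m)
  case (Suc m)
  have "(inv T ^^ Suc m) ((T ^^ Suc m) x) = (inv T ^^ m) (inv T (T ((T ^^ m) x)))"
    unfolding funpow_Suc_right[of m "inv T"] by simp
  then show ?case using Suc.IH by (simp only: inv_T)
qed simp

lemma span_induct [case_names base add shift]:
  assumes base: "\<And>a. a \<in> N \<Longrightarrow> P a"
    and add: "\<And>x y. P x \<Longrightarrow> P y \<Longrightarrow> P (x + y)"
    and shift: "\<And>x. P x \<Longrightarrow> P (T x)"
  shows "P s"
proof -
  obtain k where "s \<in> polys T N k" using span by blast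
  then obtain a where a: "\<And>i. a i \<in> N" "s = (\<Sum>i<k. (T ^^ i) (a i))" by (rule polysE) blast
  have "P ((T ^^ i) (a i))" for i
  proof -
    have "P ((T ^^ j) (a i))" for j
      using base[OF a(1)[of i]] by (induction j) (auto intro: shift)
    then show ?thesis .
  qed
  then have "P (\<Sum>i<k. (T ^^ i) (a i))"
    by (induction k) (simp_all add: base zero_in_N add)
  with a show ?thesis by simp
qed

text \<open>
  Since \<open>T\<close> can be moved out of products, a condition on all \<open>r\<close> in \<open>N\<close> extends to all of
  \<open>N[T]\<close>; in particular \<open>N\<close> inherits primeness.
\<close>
lemma N_annihilates:
  assumes "\<And>r. r \<in> N \<Longrightarrow> x * r * y = 0"
  shows "x * s * y = 0"
proof (induction s rule: span_induct)
  case (base a)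
  then show ?case by (rule assms)
next
  case (add u v)
  then show ?case by (simp add: distrib_left distrib_right)
next
  case (shift u)
  then show ?case
    by (simp add: centroid_mult_left[OF T] centroid_mult_right[OF T] centroid_zero[OF T])
qed

lemma N_prime:
  assumes "x \<noteq> 0" "y \<noteq> 0"
  obtains r where "r \<in> N" "x * r * y \<noteq> 0"
proof -
  have "\<exists>r\<in>N. x * r * y \<noteq> 0"
  proof (rule ccontr)
    assume "\<not> ?thesis"
    then have "\<And>s. x * s * y = 0" using N_annihilates by blast
    with simple_ring_prime[OF simple, of x y] assms show False by blast
  qed
  then show thesis using that by blast
qed

lemma N_nonzero: obtains a where "a \<in> N" "a \<noteq> 0"
proof -
  obtain x y :: 's where "x * y \<noteq> 0" using simple_ring_product_nonzero[OF simple] by blast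
  then have "x \<noteq> 0" "y \<noteq> 0" by auto
  then obtain r where "r \<in> N" "x * r * y \<noteq> 0" by (rule N_prime)
  then have "r \<noteq> 0" by auto
  with \<open>r \<in> N\<close> show thesis by (rule that)
qed

text \<open>
  The part of the extended centroid of \<open>N\<close> that acts on the ambient ring.  As \<open>N\<close> is prime, one
  nonzero element mapped into \<open>N\<close> already makes \<open>c\<close> map a nonzero ideal of \<open>N\<close> into \<open>N\<close>.
\<close>
definition fractions :: "('s \<Rightarrow> 's) set" where
  "fractions = {c \<in> centroid. \<exists>a\<in>N. a \<noteq> 0 \<and> c a \<in> N}"

lemma fractions_centroid: "c \<in> fractions \<Longrightarrow> c \<in> centroid"
  by (simp add: fractions_def)

lemma fractionsE:
  assumes "c \<in> fractions"
  obtains a where "a \<in> N" "a \<noteq> 0" "c a \<in> N"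
  using assms unfolding fractions_def by blast

text \<open>
  If \<open>x\<close> and \<open>y\<close> are denominators of \<open>c\<close> and \<open>c'\<close>, any nonzero \<open>x r y\<close> is a common one, because
  \<open>c\<close> can act on the left factor and \<open>c'\<close> on the right one.
\<close>
lemma common_denominator:
  assumes c: "c \<in> fractions" and c': "c' \<in> fractions"
  obtains a where "a \<in> N" "a \<noteq> 0" "c a \<in> N" "c' a \<in> N" "c (c' a) \<in> N"
proof -
  note cc = fractions_centroid[OF c] and cc' = fractions_centroid[OF c']
  obtain x where x: "x \<in> N" "x \<noteq> 0" "c x \<in> N" using c by (rule fractionsE)
  obtain y where y: "y \<in> N" "y \<noteq> 0" "c' y \<in> N" using c' by (rule fractionsE)
  obtain r where r: "r \<in> N" "x * r * y \<noteq> 0" using x(2) y(2) by (rule N_prime)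
  have "c (x * r * y) = c x * r * y"
    by (simp add: centroid_mult_left[OF cc])
  moreover have c'_eq: "c' (x * r * y) = x * r * c' y"
    by (simp add: centroid_mult_right[OF cc'])
  moreover have "c (c' (x * r * y)) = c x * r * c' y"
    unfolding c'_eq by (simp add: centroid_mult_left[OF cc])
  ultimately show thesis
    using that[of "x * r * y"] x y r N_mult by simp
qed

lemma fractions_diff:
  assumes c: "c \<in> fractions" and c': "c' \<in> fractions"
  shows "(\<lambda>x. c x - c' x) \<in> fractions"
proof -
  obtain a where "a \<in> N" "a \<noteq> 0" "c a \<in> N" "c' a \<in> N"
    using common_denominator[OF c c'] .
  moreover have "(\<lambda>x. c x - c' x) \<in> centroid"
    by (rule centroid_difference[OF fractions_centroid[OF c] fractions_centroid[OF c']])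
  ultimately show ?thesis unfolding fractions_def using N_diff by blast
qed

lemma fractions_compose:
  assumes c: "c \<in> fractions" and c': "c' \<in> fractions"
  shows "(\<lambda>x. c (c' x)) \<in> fractions"
proof -
  obtain a where "a \<in> N" "a \<noteq> 0" "c (c' a) \<in> N"
    using common_denominator[OF c c'] .
  moreover have "(\<lambda>x. c (c' x)) \<in> centroid"
    by (rule centroid_compose[OF fractions_centroid[OF c] fractions_centroid[OF c']])
  ultimately show ?thesis unfolding fractions_def by blast
qed

lemma fractions_id: "(\<lambda>x. x) \<in> fractions"
  unfolding fractions_def using id_in_centroid by (auto intro: N_nonzero)

lemma fractions_zero: "(\<lambda>x. 0) \<in> fractions"
  using fractions_diff[OF fractions_id fractions_id] by simp

lemma fractions_minus: "c \<in> fractions \<Longrightarrow> (\<lambda>x. - c x) \<in> fractions"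
  using fractions_diff[OF fractions_zero] by fastforce

lemma fractions_add: "c \<in> fractions \<Longrightarrow> c' \<in> fractions \<Longrightarrow> (\<lambda>x. c x + c' x) \<in> fractions"
  using fractions_diff[OF _ fractions_minus] by fastforce

lemma fractions_inv:
  assumes c: "c \<in> fractions" and y: "c y \<noteq> 0"
  shows "inv c \<in> fractions"
proof -
  note cc = fractions_centroid[OF c]
  have bij: "bij c" using centroid_bij[OF simple cc y] .
  obtain x where x: "x \<in> N" "x \<noteq> 0" "c x \<in> N" using c by (rule fractionsE)
  have "c x \<noteq> 0" using centroid_kernel[OF simple cc, of x y] x y by blast
  moreover have "inv c (c x) = x" using bij by (simp add: bij_is_inj)
  ultimately show ?thesis
    unfolding fractions_def using centroid_inv[OF cc bij] x by force
qed

text \<open>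
  A sum of elements \<open>c a\<close>, with \<open>c\<close> a fraction and \<open>a\<close> in \<open>N\<close>, has a denominator \<open>d\<close> of this kind.
  Working with denominators instead of such sums gives the closure properties directly, and allows
  linear relations over the closure to be cleared to relations over \<open>N\<close>.
\<close>
definition central_closure :: "'s set" where
  "central_closure = {s. \<exists>d\<in>N. d \<noteq> 0 \<and> (\<forall>r\<in>N. s * r * d \<in> N)}"

lemma central_closureE:
  assumes "s \<in> central_closure"
  obtains d where "d \<in> N" "d \<noteq> 0" "\<And>r. r \<in> N \<Longrightarrow> s * r * d \<in> N"
  using assms unfolding central_closure_def by blast

lemma central_closureI:
  "d \<in> N \<Longrightarrow> d \<noteq> 0 \<Longrightarrow> (\<And>r. r \<in> N \<Longrightarrow> s * r * d \<in> N) \<Longrightarrow> s \<in> central_closure"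
  unfolding central_closure_def by blast

lemma N_subset_closure: "a \<in> N \<Longrightarrow> a \<in> central_closure"
  by (rule N_nonzero) (blast intro: central_closureI N_mult)

lemma common_closure_denominator:
  assumes "\<And>i. i < (k::nat) \<Longrightarrow> s i \<in> central_closure"
  shows "\<exists>d\<in>N. d \<noteq> 0 \<and> (\<forall>i<k. \<forall>r\<in>N. s i * r * d \<in> N)"
  using assms
proof (induction k)
  case 0
  then show ?case using N_nonzero by auto
next
  case (Suc k)
  then obtain d where d: "d \<in> N" "d \<noteq> 0" "\<And>i r. i < k \<Longrightarrow> r \<in> N \<Longrightarrow> s i * r * d \<in> N"
    by (metis less_Suc_eq)
  obtain d' where d': "d' \<in> N" "d' \<noteq> 0" "\<And>r. r \<in> N \<Longrightarrow> s k * r * d' \<in> N"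
    using Suc.prems[of k] central_closureE by blast
  obtain q where q: "q \<in> N" "d * q * d' \<noteq> 0" using d(2) d'(2) by (rule N_prime)
  have "s i * r * (d * q * d') \<in> N" if "i < Suc k" "r \<in> N" for i r
  proof (cases "i = k")
    case True
    have "s i * r * (d * q * d') = s k * (r * d * q) * d'" by (simp add: True mult.assoc)
    then show ?thesis using d'(3)[of "r * d * q"] that d q N_mult by simp
  next
    case False
    have "s i * r * (d * q * d') = (s i * r * d) * q * d'" by (simp add: mult.assoc)
    then show ?thesis using d(3)[of i r] False that d' q N_mult by simp
  qed
  moreover have "d * q * d' \<in> N" using d(1) d'(1) q(1) N_mult by simp
  ultimately show ?case using q(2) by blast
qed

lemma closure_common:
  assumes "s \<in> central_closure" "s' \<in> central_closure"
  obtains d where "d \<in> N" "d \<noteq> 0" "\<And>r. r \<in> N \<Longrightarrow> s * r * d \<in> N" "\<And>r. r \<in> N \<Longrightarrow> s' * r * d \<in> N"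
proof -
  have "\<exists>d\<in>N. d \<noteq> 0 \<and> (\<forall>i<Suc (Suc 0). \<forall>r\<in>N. (if i = 0 then s else s') * r * d \<in> N)"
    by (rule common_closure_denominator) (use assms in auto)
  then show thesis using that by (auto simp: less_Suc_eq)
qed

lemma closure_subgroup: "additive_subgroup central_closure"
  unfolding additive_subgroup_def
proof (intro conjI ballI)
  show "0 \<in> central_closure" using N_subset_closure[OF zero_in_N] .
  fix s assume s: "s \<in> central_closure"
  then show "- s \<in> central_closure"
    using N_group by (auto simp: central_closure_def additive_subgroup_def)
  fix s' assume "s' \<in> central_closure"
  with s obtain d where "d \<in> N" "d \<noteq> 0" "\<And>r. r \<in> N \<Longrightarrow> s * r * d \<in> N"
    "\<And>r. r \<in> N \<Longrightarrow> s' * r * d \<in> N" by (rule closure_common) blast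
  then show "s + s' \<in> central_closure"
    by (intro central_closureI[of d]) (simp_all add: distrib_right N_add)
qed

lemma closure_mult:
  assumes s: "s \<in> central_closure" and s': "s' \<in> central_closure"
  shows "s * s' \<in> central_closure"
proof -
  obtain d where d: "d \<in> N" "d \<noteq> 0" "\<And>r. r \<in> N \<Longrightarrow> s * r * d \<in> N"
    using s by (rule central_closureE) blast
  obtain d' where d': "d' \<in> N" "d' \<noteq> 0" "\<And>r. r \<in> N \<Longrightarrow> s' * r * d' \<in> N"
    using s' by (rule central_closureE) blast
  obtain q where q: "q \<in> N" "d' * q * d \<noteq> 0" using d'(2) d(2) by (rule N_prime)
  have "s * s' * r * (d' * q * d) \<in> N" if "r \<in> N" for r
    using d(3)[OF N_mult[OF d'(3)[OF that] q(1)]] by (simp add: mult.assoc)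
  then show ?thesis using d(1) d'(1) q N_mult by (intro central_closureI[of "d' * q * d"]) simp_all
qed

lemma closure_fraction:
  assumes c: "c \<in> fractions" and s: "s \<in> central_closure"
  shows "c s \<in> central_closure"
proof -
  note cc = fractions_centroid[OF c]
  obtain d where d: "d \<in> N" "d \<noteq> 0" "\<And>r. r \<in> N \<Longrightarrow> s * r * d \<in> N"
    using s by (rule central_closureE) blast
  obtain x where x: "x \<in> N" "x \<noteq> 0" "c x \<in> N" using c by (rule fractionsE)
  obtain q where q: "q \<in> N" "d * q * x \<noteq> 0" using d(2) x(2) by (rule N_prime)
  have "c s * r * (d * q * x) \<in> N" if "r \<in> N" for r
  proof -
    have "c s * r * (d * q * x) = (s * r * d) * q * c x"
      by (simp add: centroid_mult_left[OF cc] centroid_mult_right[OF cc] mult.assoc)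
    then show ?thesis using d(3)[OF that] q x N_mult by simp
  qed
  then show ?thesis using d(1) x(1) q N_mult by (intro central_closureI[of "d * q * x"]) simp_all
qed

end

section \<open>The minimal equation of the centroid element\<close>

locale minimal_relation = nil_generated N T for N :: "'s::ring set" and T +
  fixes n :: nat and g :: "nat \<Rightarrow> 's"
  assumes g_in_N: "\<And>i. g i \<in> N"
    and g_top: "g n \<noteq> 0"
    and relation: "(\<Sum>i\<le>n. (T ^^ i) (g i)) = 0"
    and independent_N: "\<And>a i. (\<And>i. a i \<in> N) \<Longrightarrow> (\<Sum>i<n. (T ^^ i) (a i)) = 0 \<Longrightarrow> i < n \<Longrightarrow> a i = 0"

text \<open>
  Invertibility of \<open>T\<close> makes it algebraic: for nonzero \<open>a\<close> in \<open>N\<close>, the element \<open>T\<^sup>-\<^sup>1 a\<close> is itself a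
  polynomial \<open>p(T)\<close> over \<open>N\<close>, so \<open>T p(T) - a = 0\<close> is a nontrivial relation.
\<close>
lemma (in nil_generated) minimal_relation_exists: "\<exists>n g. minimal_relation N T n g"
proof -
  define P where "P n \<longleftrightarrow> (\<exists>g. (\<forall>i. g i \<in> N) \<and> g n \<noteq> 0 \<and> (\<Sum>i\<le>n. (T ^^ i) (g i)) = 0)" for n
  have top: "\<exists>m<k. P m"
    if "\<And>i. a i \<in> N" "(\<Sum>i<k. (T ^^ i) (a i)) = 0" "i < k" "a i \<noteq> 0" for a k i
    using that
  proof (induction k)
    case 0
    then show ?case by simp
  next
    case (Suc k)
    show ?case
    proof (cases "a k = 0")
      case True
      then have "(\<Sum>i<k. (T ^^ i) (a i)) = 0" "i < k"
        using Suc.prems centroid_zero[OF Tpow] by (auto simp: less_Suc_eq)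
      then show ?thesis using Suc.IH Suc.prems by (auto simp: less_Suc_eq)
    next
      case False
      then have "P k" using Suc.prems unfolding P_def lessThan_Suc_atMost by blast
      then show ?thesis by blast
    qed
  qed
  obtain a where a: "a \<in> N" "a \<noteq> 0" by (rule N_nonzero)
  obtain k where "inv T a \<in> polys T N k" using span by blast
  then obtain b where b: "\<And>i. b i \<in> N" "inv T a = (\<Sum>i<k. (T ^^ i) (b i))" by (rule polysE) blast
  have "(\<Sum>i<Suc k. (T ^^ i) (case i of 0 \<Rightarrow> - a | Suc j \<Rightarrow> b j)) = - a + T (inv T a)"
    unfolding b(2) sum.lessThan_Suc_shift by (simp add: centroid_sum[OF T])
  then have "(\<Sum>i<Suc k. (T ^^ i) (case i of 0 \<Rightarrow> - a | Suc j \<Rightarrow> b j)) = 0"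
    by (simp add: T_inv)
  moreover have "(case i of 0 \<Rightarrow> - a | Suc j \<Rightarrow> b j) \<in> N" for i
    using N_group a b by (simp add: additive_subgroup_def split: nat.split)
  ultimately have "\<exists>m. P m"
    using top[of "\<lambda>i. case i of 0 \<Rightarrow> - a | Suc j \<Rightarrow> b j" "Suc k" 0] a by auto
  then have "P (LEAST m. P m)" by (rule LeastI_ex)
  then obtain g where g: "\<And>i. g i \<in> N" "g (LEAST m. P m) \<noteq> 0"
    "(\<Sum>i\<le>(LEAST m. P m). (T ^^ i) (g i)) = 0" unfolding P_def by blast
  have "minimal_relation N T (LEAST m. P m) g"
  proof (unfold_locales)
    fix a i
    assume "\<And>i. a i \<in> N" "(\<Sum>i<(LEAST m. P m). (T ^^ i) (a i)) = 0" "i < (LEAST m. P m)"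
    then show "a i = 0" using top[of a "LEAST m. P m" i] not_less_Least by blast
  qed (use g in auto)
  then show ?thesis by blast
qed

context minimal_relation
begin

lemma n_pos: "0 < n"
proof (rule ccontr)
  assume "\<not> 0 < n"
  with relation g_top show False by simp
qed

text \<open>
  The difference of \<open>g n * s\<close> times the relation and the relation times \<open>s * g n\<close> has no term of
  degree \<open>n\<close>, so by minimality all its coefficients vanish.
\<close>
lemma relation_commutes:
  assumes i: "i \<le> n"
  shows "g n * s * g i = g i * s * g n"
proof (induction s rule: span_induct)
  case (base r)
  define a where "a j = g n * r * g j - g j * r * g n" for j
  have "(\<Sum>j\<le>n. (T ^^ j) (a j)) =
      (g n * r) * (\<Sum>j\<le>n. (T ^^ j) (g j)) - (\<Sum>j\<le>n. (T ^^ j) (g j)) * (r * g n)"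
    by (simp add: a_def centroid_diff[OF Tpow] sum_subtractf sum_distrib_left sum_distrib_right
        centroid_mult_left[OF Tpow] centroid_mult_right[OF Tpow] mult.assoc)
  also have "\<dots> = 0" by (simp add: relation)
  finally have "(\<Sum>j\<le>n. (T ^^ j) (a j)) = 0" .
  moreover have "a n = 0" by (simp add: a_def)
  ultimately have "(\<Sum>j<n. (T ^^ j) (a j)) = 0"
    using centroid_zero[OF Tpow] by (simp add: lessThan_Suc_atMost[symmetric])
  moreover have "a j \<in> N" for j
    using base g_in_N N_mult N_diff by (simp add: a_def)
  ultimately have "a i = 0"
    using independent_N[of a i] i \<open>a n = 0\<close> by (cases "i = n") auto
  then show ?case by (simp add: a_def)
next
  case (add x y)
  then show ?case by (simp add: distrib_left distrib_right)
next
  case (shift x)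
  then show ?case by (simp add: centroid_mult_left[OF T] centroid_mult_right[OF T])
qed

text \<open>
  The coefficients of the monic minimal polynomial of \<open>T\<close>, obtained as the scalars \<open>g i / g n\<close>.
\<close>
definition coeff :: "nat \<Rightarrow> 's \<Rightarrow> 's" where
  "coeff i = (SOME \<phi>. \<phi> \<in> centroid \<and> \<phi> (g n) = g i)"

lemma coeff:
  assumes "i \<le> n"
  shows coeff_centroid: "coeff i \<in> centroid" and coeff_top: "coeff i (g n) = g i"
proof -
  have "\<exists>\<phi>. \<phi> \<in> centroid \<and> \<phi> (g n) = g i"
    using centroid_extension[OF simple g_top relation_commutes[OF assms]] by blast
  from someI_ex[OF this] show "coeff i \<in> centroid" "coeff i (g n) = g i"
    by (simp_all add: coeff_def)
qed

lemma coeff_fractions: "i \<le> n \<Longrightarrow> coeff i \<in> fractions"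
  unfolding fractions_def using coeff g_top g_in_N by force

lemma coeff_relation: "(\<Sum>i\<le>n. (T ^^ i) (coeff i s)) = 0"
proof -
  have "(\<lambda>s. \<Sum>i\<le>n. (T ^^ i) (coeff i s)) \<in> centroid"
    by (rule centroid_sum_closed, rule centroid_compose[OF Tpow coeff_centroid]) simp
  moreover have "(\<Sum>i\<le>n. (T ^^ i) (coeff i (g n))) = 0"
    using relation by (simp add: coeff_top)
  ultimately show ?thesis
    using centroid_kernel[OF simple _ _ g_top, of "\<lambda>s. \<Sum>i\<le>n. (T ^^ i) (coeff i s)"] by blast
qed

lemma coeff_n: "coeff n s = s"
proof -
  have "(\<lambda>s. coeff n s - s) \<in> centroid"
    by (rule centroid_difference[OF coeff_centroid id_in_centroid]) simp
  from centroid_kernel[OF simple this _ g_top, of s] show ?thesis by (simp add: coeff_top)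
qed

lemma T_power_n: "(T ^^ n) s = (\<Sum>i<n. (T ^^ i) (- coeff i s))"
  using coeff_relation[of s]
  by (simp add: lessThan_Suc_atMost[symmetric] coeff_n centroid_minus[OF Tpow] sum_negf
      eq_neg_iff_add_eq_0 add.commute)

text \<open>
  Otherwise the relation could be divided by \<open>T\<close>.
\<close>
lemma coeff_0_nonzero: "\<exists>s. coeff 0 s \<noteq> 0"
proof (rule ccontr)
  assume "\<not> ?thesis"
  then have "g 0 = 0" using coeff_top[of 0] by simp
  moreover have "(\<Sum>i<Suc n. (T ^^ i) (g i)) = g 0 + T (\<Sum>i<n. (T ^^ i) (g (Suc i)))"
    unfolding sum.lessThan_Suc_shift by (simp add: centroid_sum[OF T])
  ultimately have "T (\<Sum>i<n. (T ^^ i) (g (Suc i))) = 0"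
    using relation by (simp only: lessThan_Suc_atMost add_0)
  then have "(\<Sum>i<n. (T ^^ i) (g (Suc i))) = 0"
    using inv_T[of "\<Sum>i<n. (T ^^ i) (g (Suc i))"] centroid_zero[OF inv_T_centroid] by simp
  then have "g (Suc (n - 1)) = 0"
    using independent_N[of "\<lambda>i. g (Suc i)" "n - 1"] g_in_N n_pos by simp
  with g_top n_pos show False by simp
qed

text \<open>
  Solve the minimal equation for \<open>T\<^sup>-\<^sup>1\<close>, dividing by its constant coefficient.
\<close>
lemma inv_T_expansion:
  "\<exists>p. (\<forall>i. p i \<in> fractions) \<and> (\<forall>s. inv T s = (\<Sum>i<n. (T ^^ i) (p i s)))"
proof -
  define q where "q = inv (coeff 0)"
  have q: "q \<in> fractions"
    unfolding q_def using coeff_0_nonzero fractions_inv[OF coeff_fractions] by blast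
  have "bij (coeff 0)"
    using coeff_0_nonzero centroid_bij[OF simple coeff_centroid] by blast
  then have cq: "coeff 0 (q s) = s" for s
    by (simp add: q_def bij_is_surj surj_f_inv_f)
  define p where "p i = (if i < n then (\<lambda>s. - coeff (Suc i) (q s)) else (\<lambda>s. 0))" for i
  have "p i \<in> fractions" for i
    unfolding p_def
    using fractions_zero fractions_minus[OF fractions_compose[OF coeff_fractions q]] by simp
  moreover have "inv T s = (\<Sum>i<n. (T ^^ i) (p i s))" for s
  proof -
    have "(\<Sum>i<Suc n. (T ^^ i) (coeff i (q s))) = s + T (\<Sum>i<n. (T ^^ i) (coeff (Suc i) (q s)))"
      unfolding sum.lessThan_Suc_shift by (simp add: cq centroid_sum[OF T])
    then have "s + T (\<Sum>i<n. (T ^^ i) (coeff (Suc i) (q s))) = 0"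
      using coeff_relation[of "q s"] by (simp only: lessThan_Suc_atMost)
    then have "s = T (- (\<Sum>i<n. (T ^^ i) (coeff (Suc i) (q s))))"
      by (simp add: centroid_minus[OF T] eq_neg_iff_add_eq_0)
    then have "inv T s = - (\<Sum>i<n. (T ^^ i) (coeff (Suc i) (q s)))"
      using inv_T by metis
    also have "\<dots> = (\<Sum>i<n. (T ^^ i) (p i s))"
      by (simp add: p_def centroid_minus[OF Tpow] sum_negf)
    finally show ?thesis .
  qed
  ultimately show ?thesis by blast
qed

lemma inv_T_power_expansion:
  "\<exists>c. (\<forall>i. c i \<in> fractions) \<and> (\<forall>s. (inv T ^^ m) s = (\<Sum>i<n. (T ^^ i) (c i s)))"
proof (induction m)
  case 0
  have "s = (\<Sum>i<n. (T ^^ i) ((if i = 0 then (\<lambda>s. s) else (\<lambda>s. 0)) s))" for s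
  proof -
    have "(\<Sum>i<n. (T ^^ i) ((if i = 0 then (\<lambda>s. s) else (\<lambda>s. 0)) s)) = (\<Sum>i<n. if i = 0 then s else 0)"
      by (rule sum.cong) (auto simp: centroid_zero[OF Tpow])
    then show ?thesis using n_pos by simp
  qed
  then show ?case
    using fractions_id fractions_zero
    by (intro exI[of _ "\<lambda>i. if i = 0 then (\<lambda>s. s) else (\<lambda>s. 0)"]) simp
next
  case (Suc m)
  then obtain c where c: "\<And>i. c i \<in> fractions" "\<And>s. (inv T ^^ m) s = (\<Sum>i<n. (T ^^ i) (c i s))"
    by blast
  obtain p where p: "\<And>i. p i \<in> fractions" "\<And>s. inv T s = (\<Sum>i<n. (T ^^ i) (p i s))"
    using inv_T_expansion by blast
  obtain n' where n': "n = Suc n'" using n_pos gr0_conv_Suc by blast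
  \<comment> \<open>Dividing \<open>\<Sum> T\<^sup>i c i\<close> by \<open>T\<close> shifts all terms down except the constant one, which is expanded
    by \<open>p\<close>.\<close>
  define e where "e i = (\<lambda>s. p i (c 0 s) + (if i < n' then c (Suc i) else (\<lambda>s. 0)) s)" for i
  have "e i \<in> fractions" for i
    unfolding e_def
    by (rule fractions_add[OF fractions_compose[OF p(1) c(1)]]) (simp add: c fractions_zero)
  moreover have "(inv T ^^ Suc m) s = (\<Sum>i<n. (T ^^ i) (e i s))" for s
  proof -
    have "(\<Sum>i<Suc n'. (T ^^ i) (c i s)) = c 0 s + T (\<Sum>i<n'. (T ^^ i) (c (Suc i) s))"
      unfolding sum.lessThan_Suc_shift by (simp add: centroid_sum[OF T])
    then have "(inv T ^^ Suc m) s = inv T (c 0 s) + (\<Sum>i<n'. (T ^^ i) (c (Suc i) s))"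
      by (simp add: c(2) n' centroid_add[OF inv_T_centroid] inv_T del: sum.lessThan_Suc)
    moreover have "(\<Sum>i<n. (T ^^ i) (e i s)) = inv T (c 0 s) + (\<Sum>i<n'. (T ^^ i) (c (Suc i) s))"
      unfolding p(2) e_def
      by (simp add: n' centroid_add[OF Tpow] sum.distrib centroid_zero[OF Tpow] add.assoc)
    ultimately show ?thesis by simp
  qed
  ultimately show ?case by blast
qed

text \<open>
  Multiplying by a common denominator turns a relation over the closure into one over \<open>N\<close>.
\<close>
lemma independent_closure:
  assumes s: "\<And>i. s i \<in> central_closure" and zero: "(\<Sum>i<n. (T ^^ i) (s i)) = 0" and i: "i < n"
  shows "s i = 0"
proof -
  have "\<exists>d\<in>N. d \<noteq> 0 \<and> (\<forall>i<n. \<forall>r\<in>N. s i * r * d \<in> N)"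
    by (rule common_closure_denominator) (rule s)
  then obtain d where d: "d \<in> N" "d \<noteq> 0" "\<forall>i<n. \<forall>r\<in>N. s i * r * d \<in> N" by blast
  have "s i * r * d = 0" if r: "r \<in> N" for r
  proof -
    have "(\<Sum>j<n. (T ^^ j) (if j < n then s j * r * d else 0)) = (\<Sum>j<n. (T ^^ j) (s j)) * (r * d)"
      by (simp add: sum_distrib_right centroid_mult_left[OF Tpow] mult.assoc)
    then have "(\<Sum>j<n. (T ^^ j) (if j < n then s j * r * d else 0)) = 0"
      using zero by simp
    then have "(if i < n then s i * r * d else 0) = 0"
      by (rule independent_N[rotated]) (use d(3) r i zero_in_N in auto)
    with i show ?thesis by simp
  qed
  then show ?thesis
    using simple_ring_prime[OF simple _ d(2)] N_annihilates by blast
qed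

lemma zero_in_closure: "0 \<in> central_closure"
  using closure_subgroup by (simp add: additive_subgroup_def)

lemmas closure_diff = additive_subgroup_diff[OF closure_subgroup]
lemmas closure_polys_subgroup = polys_subgroup[OF T closure_subgroup]

lemma closure_spans: "s \<in> polys T central_closure n"
proof (induction s rule: span_induct)
  case (base a)
  show ?case by (rule polys_const[OF T zero_in_closure N_subset_closure[OF base] n_pos])
next
  case (add x y)
  then show ?case using closure_polys_subgroup by (simp add: additive_subgroup_def)
next
  case (shift x)
  then have "T x \<in> polys T central_closure (Suc n)"
    using polys_apply[OF T zero_in_closure] by blast
  then obtain a where a: "\<And>i. a i \<in> central_closure" "T x = (\<Sum>i<Suc n. (T ^^ i) (a i))"
    by (rule polysE) blast
  have "T x = (\<Sum>i<n. (T ^^ i) (a i)) + (\<Sum>i<n. (T ^^ i) (- coeff i (a n)))"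
    unfolding a(2) by (simp add: T_power_n)
  also have "\<dots> = (\<Sum>i<n. (T ^^ i) (a i - coeff i (a n)))"
    by (simp add: centroid_diff[OF Tpow] centroid_minus[OF Tpow] sum_subtractf sum_negf)
  also have "\<dots> \<in> polys T central_closure n"
    by (rule polysI)
      (use a closure_diff closure_fraction coeff_fractions zero_in_closure in auto)
  finally show ?case .
qed

section \<open>Ideals of coefficients absorbing powers of the centroid element\<close>

text \<open>
  Coefficients that can absorb fewer than \<open>k\<close> extra powers of \<open>T\<close> and still give polynomials of
  degree less than \<open>n\<close> over \<open>N\<close>.
\<close>
definition bounded_ideal :: "nat \<Rightarrow> 's set" where
  "bounded_ideal k = {a \<in> N. \<forall>j<k. (T ^^ j) a \<in> polys T N n}"

lemma bounded_ideal_subgroup: "additive_subgroup (bounded_ideal k)"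
  using N_group polys_subgroup[OF T N_group, of n]
  by (auto simp: bounded_ideal_def additive_subgroup_def centroid_zero[OF Tpow]
      centroid_add[OF Tpow] centroid_minus[OF Tpow])

lemma bounded_ideal_mult:
  assumes a: "a \<in> bounded_ideal k" and r: "r \<in> N"
  shows "a * r \<in> bounded_ideal k" "r * a \<in> bounded_ideal k"
proof -
  have "(T ^^ j) a * r \<in> polys T N n" "r * (T ^^ j) a \<in> polys T N n" if "j < k" for j
    using that a r N_mult zero_in_N
    by (auto simp: bounded_ideal_def intro: polys_mult_left[OF T] polys_mult_right[OF T])
  then show "a * r \<in> bounded_ideal k" "r * a \<in> bounded_ideal k"
    using a r N_mult
    by (auto simp: bounded_ideal_def centroid_mult_left[OF Tpow] centroid_mult_right[OF Tpow])
qed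

text \<open>
  Multiplication by \<open>g n\<close> clears the denominators in the minimal equation, so a term of degree \<open>n\<close>
  can be rewritten by lower ones without leaving \<open>N\<close>.
\<close>
lemma polys_Suc_times_top:
  assumes x: "x \<in> polys T N (Suc n)" and r: "r \<in> N"
  shows "x * (r * g n) \<in> polys T N n"
proof -
  obtain a where a: "\<And>i. a i \<in> N" "x = (\<Sum>i<Suc n. (T ^^ i) (a i))"
    using x by (rule polysE) blast
  have "(T ^^ n) (a n * (r * g n)) = (\<Sum>i<n. (T ^^ i) (- (a n * r * g i)))"
    unfolding T_power_n
    by (rule sum.cong) (simp_all add: centroid_mult_right[OF coeff_centroid, symmetric] coeff_top mult.assoc)
  then have "x * (r * g n) = (\<Sum>i<n. (T ^^ i) (a i * (r * g n) - a n * r * g i))"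
    unfolding a(2)
    by (simp add: distrib_right sum_distrib_right centroid_mult_left[OF Tpow] sum_subtractf
        centroid_diff[OF Tpow] centroid_minus[OF Tpow] sum_negf)
  also have "\<dots> \<in> polys T N n"
    by (rule polysI) (use a r g_in_N N_mult N_diff zero_in_N in auto)
  finally show ?thesis .
qed

text \<open>
  If \<open>a\<close> absorbs fewer than \<open>k\<close> powers, then \<open>T\<^sup>k a\<close> still has degree at most \<open>n\<close>, so
  \<open>polys_Suc_times_top\<close> provides multiples of \<open>a\<close> that absorb one power more.
\<close>
lemma bounded_ideal_nonzero: "\<exists>a\<in>bounded_ideal k. a \<noteq> 0"
proof (induction k)
  case 0
  then show ?case using N_nonzero by (auto simp: bounded_ideal_def)
next
  case (Suc k)
  then obtain a where a: "a \<in> N" "a \<noteq> 0" "\<And>j. j < k \<Longrightarrow> (T ^^ j) a \<in> polys T N n"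
    by (auto simp: bounded_ideal_def)
  obtain r where r: "r \<in> N" "a * r * g n \<noteq> 0" using a(2) g_top by (rule N_prime)
  have "(T ^^ j) a \<in> polys T N (Suc n)" if "j < Suc k" for j
  proof (cases j)
    case 0
    then show ?thesis using polys_const[OF T zero_in_N a(1), of "Suc n"] by simp
  next
    case (Suc i)
    then show ?thesis using polys_apply[OF T zero_in_N] a(3)[of i] that by simp
  qed
  then have "(T ^^ j) (a * (r * g n)) \<in> polys T N n" if "j < Suc k" for j
    using polys_Suc_times_top[OF _ r(1)] that by (simp add: centroid_mult_left[OF Tpow, symmetric])
  then have "a * (r * g n) \<in> bounded_ideal (Suc k)"
    using a r g_in_N N_mult by (simp add: bounded_ideal_def)
  with r show ?case by (auto simp: mult.assoc)
qed

text \<open>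
  The polynomials in \<open>T\<close> over a nonzero ideal of \<open>N\<close> form a nonzero two-sided ideal of the simple ring.
\<close>
lemma bounded_ideal_spans: "\<exists>l. s \<in> polys T (bounded_ideal k) l"
proof -
  let ?L = "bounded_ideal k"
  let ?I = "{s. \<exists>l. s \<in> polys T ?L l}"
  have L0: "0 \<in> ?L" using bounded_ideal_subgroup by (simp add: additive_subgroup_def)
  note sub = polys_subgroup[OF T bounded_ideal_subgroup, of k]
  have sum_in: "x + y \<in> ?I" if x: "x \<in> ?I" and y: "y \<in> ?I" for x y
  proof -
    obtain l where l: "x \<in> polys T ?L l" using x by blast
    obtain l' where l': "y \<in> polys T ?L l'" using y by blast
    have "x \<in> polys T ?L (max l l')" "y \<in> polys T ?L (max l l')"
      by (rule polys_mono[OF T L0 _ l] polys_mono[OF T L0 _ l'], simp)+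
    then have "x + y \<in> polys T ?L (max l l')"
      using sub[of "max l l'"] by (simp add: additive_subgroup_def)
    then show ?thesis by blast
  qed
  have mult: "x * s \<in> ?I \<and> s * x \<in> ?I" if x: "x \<in> ?I" for x s
  proof (induction s rule: span_induct)
    case (base r)
    obtain l where l: "x \<in> polys T ?L l" using x by blast
    show ?case
      using polys_mult_left[OF T l bounded_ideal_mult(2)[OF _ base] L0]
        polys_mult_right[OF T l bounded_ideal_mult(1)[OF _ base] L0] by blast
  next
    case (add u v)
    then show ?case using sum_in by (simp only: distrib_left distrib_right)
  next
    case (shift u)
    have "T y \<in> ?I" if "y \<in> ?I" for y using that polys_apply[OF T L0] by blast
    with shift show ?case
      by (simp only: centroid_mult_left[OF T] centroid_mult_right[OF T])
  qed
  have "- x \<in> ?I" if x: "x \<in> ?I" for x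
  proof -
    obtain l where "x \<in> polys T ?L l" using x by blast
    then have "- x \<in> polys T ?L l" using sub[of l] by (simp add: additive_subgroup_def)
    then show ?thesis by blast
  qed
  moreover have "0 \<in> ?I" using sub[of 0] by (auto simp: additive_subgroup_def)
  ultimately have "two_sided_ideal ?I"
    unfolding two_sided_ideal_def additive_subgroup_def using sum_in mult by blast
  moreover obtain a where a: "a \<in> ?L" "a \<noteq> 0" using bounded_ideal_nonzero by blast
  moreover have "a \<in> ?I" using polys_const[OF T L0 a(1)] by blast
  ultimately have "?I = UNIV" using simple_ring_ideal_UNIV[OF simple] by blast
  then show ?thesis by blast
qed

end

section \<open>Quasi-regularity of the central closure\<close>

text \<open>
  The class of \<open>s\<close> modulo \<open>Q\<close> is fixed by right multiplication with \<open>s\<close>, hence \<open>c s \<equiv> e\<close> says that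
  right multiplication by \<open>e\<close> acts on this class as the scalar \<open>c\<close>, and powers of \<open>e\<close> as powers of
  \<open>c\<close>.
\<close>
lemma nilpotent_scalar_mod_right_ideal:
  assumes Q: "right_ideal Q" and cQ: "\<And>q. q \<in> Q \<Longrightarrow> c q \<in> Q" and c: "c \<in> centroid"
    and unit: "\<And>a. a - s * a \<in> Q" and e: "c s - e \<in> Q" and nil: "nilpotent e"
  shows "\<exists>k. (c ^^ k) s \<in> Q"
proof -
  have Qadd: "\<And>x y. x \<in> Q \<Longrightarrow> y \<in> Q \<Longrightarrow> x + y \<in> Q" and Qr: "\<And>q r. q \<in> Q \<Longrightarrow> q * r \<in> Q"
    and Qminus: "\<And>x. x \<in> Q \<Longrightarrow> - x \<in> Q"
    using Q by (auto simp: right_ideal_def additive_subgroup_def)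
  have "(c ^^ Suc k) s - ((*) e ^^ k) e \<in> Q" for k
  proof (induction k)
    case 0
    then show ?case using e by simp
  next
    case (Suc k)
    let ?E = "((*) e ^^ k) e"
    have "(c ^^ Suc (Suc k)) s - ((*) e ^^ Suc k) e =
        c ((c ^^ Suc k) s - ?E) + c (?E - s * ?E) + (c s - e) * ?E"
      by (simp add: centroid_diff[OF c] centroid_mult_left[OF c] left_diff_distrib)
    also have "\<dots> \<in> Q" by (intro Qadd Qr cQ Suc.IH unit e)
    finally show ?case .
  qed
  moreover obtain k where "((*) e ^^ k) e = 0" using nil by (auto simp: nilpotent_def)
  ultimately have "(c ^^ Suc k) s \<in> Q" by (metis diff_zero)
  then show ?thesis by blast
qed

text \<open>
  Removing the constant term \<open>a \<equiv> s a\<close> of a polynomial \<open>a + T x'\<close> changes only the \<open>d\<close> lowest terms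
  of \<open>x'\<close>, because \<open>s\<close> is \<open>T\<close> times a polynomial of degree less than \<open>d\<close>.  So each step takes out one factor
  \<open>T\<close> and shortens the polynomial by one term, as long as it has more than \<open>d\<close> terms.
\<close>
lemma polys_width_reduction:
  assumes T: "T \<in> centroid" and Q: "right_ideal Q" and TQ: "\<And>q. q \<in> Q \<Longrightarrow> T q \<in> Q"
    and unit: "\<And>a. a - s * a \<in> Q" and s: "s = T (\<Sum>j<d. (T ^^ j) (b j))"
    and A: "additive_subgroup A" and bA: "\<And>j a. a \<in> A \<Longrightarrow> b j * a \<in> A"
  shows "x \<in> polys T A (d + k) \<Longrightarrow> \<exists>m. \<exists>z\<in>polys T A d. x - (T ^^ m) z \<in> Q"
proof (induction k arbitrary: x)
  case 0
  have "x - (T ^^ 0) x \<in> Q" using Q by (simp add: right_ideal_def additive_subgroup_def)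
  with 0 show ?case by (intro exI[of _ 0] bexI[of _ x]) simp_all
next
  case (Suc k)
  have Qadd: "\<And>x y. x \<in> Q \<Longrightarrow> y \<in> Q \<Longrightarrow> x + y \<in> Q"
    using Q by (auto simp: right_ideal_def additive_subgroup_def)
  have A0: "0 \<in> A" using A by (simp add: additive_subgroup_def)
  obtain a x' where a: "a \<in> A" and x': "x' \<in> polys T A (d + k)" and x: "x = a + T x'"
    using Suc.prems polys_Suc_split[OF T, of x A "d + k"] by auto
  define y where "y = (\<Sum>j<d. (T ^^ j) (b j * a))"
  have "y \<in> polys T A d" unfolding y_def by (rule polysI) (use a A0 bA in auto)
  then have "y \<in> polys T A (d + k)" by (rule polys_mono[OF T A0, rotated]) simp
  with x' have "y + x' \<in> polys T A (d + k)"
    using polys_subgroup[OF T A] by (simp add: additive_subgroup_def)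
  from Suc.IH[OF this] obtain m z where z: "z \<in> polys T A d" "y + x' - (T ^^ m) z \<in> Q" by blast
  have "s * a = T y"
    by (simp add: s y_def centroid_mult_left[OF T] sum_distrib_right
        centroid_mult_left[OF centroid_funpow[OF T]])
  then have "x - (T ^^ Suc m) z = (a - s * a) + T (y + x' - (T ^^ m) z)"
    by (simp add: x centroid_diff[OF T] centroid_add[OF T])
  also have "\<dots> \<in> Q" by (intro Qadd TQ unit z)
  finally show ?case using z by blast
qed

lemma (in minimal_relation) central_closure_quasi_regular:
  assumes sR: "s \<in> central_closure"
  shows "\<exists>y\<in>central_closure. s = y - s * y"
proof -
  let ?R = central_closure
  define Q where "Q = range (\<lambda>y. y - s * y)"
  have QI: "y - s * y \<in> Q" for y by (simp add: Q_def)
  have Q: "right_ideal Q"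
    unfolding right_ideal_def additive_subgroup_def Q_def
  proof (intro conjI ballI allI)
    show "0 \<in> range (\<lambda>y. y - s * y)" by (rule range_eqI[of _ _ 0]) simp
    fix p assume "p \<in> range (\<lambda>y. y - s * y)"
    then obtain u where u: "p = u - s * u" by blast
    show "- p \<in> range (\<lambda>y. y - s * y)" by (rule range_eqI[of _ _ "- u"]) (simp add: u)
    show "p * r \<in> range (\<lambda>y. y - s * y)" for r
      by (rule range_eqI[of _ _ "u * r"]) (simp add: u left_diff_distrib mult.assoc)
    fix q assume "q \<in> range (\<lambda>y. y - s * y)"
    then obtain v where v: "q = v - s * v" by blast
    show "p + q \<in> range (\<lambda>y. y - s * y)"
      by (rule range_eqI[of _ _ "u + v"]) (simp add: u v distrib_left)
  qed
  have cQ: "c q \<in> Q" if c: "c \<in> centroid" and q: "q \<in> Q" for c q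
  proof -
    obtain y where "q = y - s * y" using q by (auto simp: Q_def)
    then have "c q = c y - s * c y"
      by (simp add: centroid_diff[OF c] centroid_mult_right[OF c])
    then show ?thesis by (simp add: QI)
  qed
  \<comment> \<open>\<open>Q\<close> is the direct sum of the \<open>T\<^sup>i (1 - s) R\<close>, so congruences may be compared coefficientwise.\<close>
  have component: "\<exists>y\<in>?R. r i = y - s * y"
    if r: "\<And>i. r i \<in> ?R" and rQ: "(\<Sum>i<n. (T ^^ i) (r i)) \<in> Q" and i: "i < n" for r i
  proof -
    obtain y where y: "(\<Sum>i<n. (T ^^ i) (r i)) = y - s * y" using rQ by (auto simp: Q_def)
    obtain u where u: "\<And>i. u i \<in> ?R" "y = (\<Sum>i<n. (T ^^ i) (u i))"
      using closure_spans[of y] by (rule polysE) blast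
    have "(\<Sum>i<n. (T ^^ i) (r i - (u i - s * u i))) = 0"
      using y by (simp add: u(2) centroid_diff[OF Tpow] sum_subtractf sum_distrib_left
          centroid_mult_right[OF Tpow])
    then have "r i - (u i - s * u i) = 0"
      by (rule independent_closure[rotated]) (intro i closure_diff closure_mult r u(1) sR)+
    with u(1) show ?thesis by auto
  qed
  have "s \<in> Q"
  proof (cases "s = 0")
    case True
    then show ?thesis using QI[of 0] by simp
  next
    case False
    obtain d where "inv T s \<in> polys T N d" using span by blast
    then obtain b where b: "\<And>j. b j \<in> N" "inv T s = (\<Sum>j<d. (T ^^ j) (b j))"
      by (rule polysE) blast
    have sT: "s = T (\<Sum>j<d. (T ^^ j) (b j))" using T_inv[of s] b(2) by simp
    let ?L = "bounded_ideal d"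
    have L0: "0 \<in> ?L" using bounded_ideal_subgroup by (simp add: additive_subgroup_def)
    obtain l where l: "s \<in> polys T ?L l" using bounded_ideal_spans by blast
    \<comment> \<open>The width \<open>d\<close> comes from a first expression of \<open>s\<close> over \<open>N\<close>; only then is the ideal chosen that
      absorbs \<open>d\<close> powers of \<open>T\<close>, and \<open>s\<close> expressed again over it, with no control on \<open>l\<close>.\<close>
    have "s \<in> polys T ?L (d + l)" by (rule polys_mono[OF T L0 _ l]) simp
    then obtain m z where z: "z \<in> polys T ?L d" "s - (T ^^ m) z \<in> Q"
      using polys_width_reduction[OF T Q cQ[OF T] QI sT bounded_ideal_subgroup
          bounded_ideal_mult(2)[OF _ b(1)]] by blast
    obtain a where a: "\<And>i. a i \<in> ?L" "z = (\<Sum>i<d. (T ^^ i) (a i))"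
      using z(1) by (rule polysE) blast
    have "z \<in> polys T N n"
      unfolding a(2)
      by (rule additive_subgroup_sum[OF polys_subgroup[OF T N_group]])
        (use a(1) in \<open>auto simp: bounded_ideal_def\<close>)
    then obtain e where e: "\<And>i. e i \<in> N" "z = (\<Sum>i<n. (T ^^ i) (e i))" by (rule polysE) blast
    obtain c where c: "\<And>i. c i \<in> fractions" "\<And>s. (inv T ^^ m) s = (\<Sum>i<n. (T ^^ i) (c i s))"
      using inv_T_power_expansion by blast
    note cc = fractions_centroid[OF c(1)]
    note iTm = centroid_funpow[OF inv_T_centroid, of m]
    have "(inv T ^^ m) (s - (T ^^ m) z) \<in> Q" by (rule cQ[OF iTm z(2)])
    also have "(inv T ^^ m) (s - (T ^^ m) z) = (\<Sum>i<n. (T ^^ i) (c i s - e i))"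
      by (simp add: centroid_diff[OF iTm] inv_T_funpow c(2)[of s] e(2)
          centroid_diff[OF Tpow] sum_subtractf)
    finally have sum_in_Q: "(\<Sum>i<n. (T ^^ i) (c i s - e i)) \<in> Q" .
    have congruent: "c i s - e i \<in> Q" if i: "i < n" for i
    proof -
      have "c i s - e i \<in> ?R" for i
        by (rule closure_diff[OF closure_fraction[OF c(1) sR] N_subset_closure[OF e(1)]])
      from component[OF this sum_in_Q i] QI show ?thesis by force
    qed
    have "(inv T ^^ m) s \<noteq> 0"
    proof
      assume "(inv T ^^ m) s = 0"
      then have "s = 0"
        using centroid_kernel[OF simple iTm, of s "(T ^^ m) s"] inv_T_funpow[of m s] by auto
      with False show False ..
    qed
    moreover have "(inv T ^^ m) s = 0" if "\<forall>i<n. c i s = 0"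
      using that by (simp add: c(2)[of s] centroid_zero[OF Tpow])
    ultimately obtain i where i: "i < n" "c i s \<noteq> 0" by blast
    obtain k where k: "(c i ^^ k) s \<in> Q"
      using nilpotent_scalar_mod_right_ideal[OF Q cQ[OF cc] cc QI congruent[OF i(1)] N_nil[OF e(1)]]
      by blast
    have bij: "bij (c i)" using centroid_bij[OF simple cc i(2)] .
    note inv_c = centroid_inv[OF cc bij]
    have "(c i ^^ j) s \<in> Q \<Longrightarrow> s \<in> Q" for j
    proof (induction j)
      case (Suc j)
      have "inv (c i) (c i ((c i ^^ j) s)) \<in> Q" using cQ[OF inv_c] Suc.prems by simp
      then show ?case using Suc.IH bij by (simp add: bij_is_inj)
    qed simp
    with k show ?thesis by blast
  qed
  moreover have "(\<Sum>i<n. (T ^^ i) (if i = 0 then s else 0)) = (\<Sum>i<n. if i = 0 then s else 0)"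
    by (rule sum.cong) (auto simp: centroid_zero[OF Tpow])
  ultimately have "(\<Sum>i<n. (T ^^ i) (if i = 0 then s else 0)) \<in> Q"
    using n_pos by simp
  from component[OF _ this n_pos] show ?thesis
    using sR zero_in_closure by (simp split: if_splits)
qed

section \<open>Modular right ideals\<close>

lemma modular_right_ideal_UNIV:
  assumes Q: "right_ideal Q" and unit: "\<And>a. a - b * a \<in> Q" and b: "b \<in> Q"
  shows "Q = UNIV"
proof -
  have "a \<in> Q" for a
  proof -
    have "b * a \<in> Q" using Q b by (simp add: right_ideal_def)
    with unit[of a] have "(a - b * a) + b * a \<in> Q"
      using Q unfolding right_ideal_def additive_subgroup_def by blast
    then show ?thesis by simp
  qed
  then show ?thesis by auto
qed

text \<open>
  If \<open>b\<close> is a left unit modulo \<open>Q\<close>, then \<open>T\<^sup>i b \<equiv> b (T\<^sup>i b)\<close>.  Expanding the factor \<open>T\<^sup>i b\<close> over the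
  closure expresses it by \<open>b, T b, \<dots>, T\<^sup>n\<^sup>-\<^sup>1 b\<close>, and Nakayama's lemma applies.
\<close>
theorem (in nil_generated) modular_right_ideals_trivial:
  assumes "modular_right_ideal (Q :: 's set)"
  shows "Q = UNIV"
proof -
  obtain n g where "minimal_relation N T n g" using minimal_relation_exists by blast
  then interpret minimal_relation N T n g .
  obtain b where Q: "right_ideal Q" and b: "\<And>a. a - b * a \<in> Q"
    using assms by (auto simp: modular_right_ideal_def)
  have "(T ^^ i) b \<in> Q" if "i < n" for i
  proof (rule nakayama[OF Q closure_subgroup closure_mult central_closure_quasi_regular, of n])
    fix i
    obtain r where r: "\<And>j. r j \<in> central_closure" "(T ^^ i) b = (\<Sum>j<n. (T ^^ j) (r j))"
      using closure_spans[of "(T ^^ i) b"] by (rule polysE) blast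
    have "(\<Sum>j<n. (T ^^ j) b * r j) = b * (T ^^ i) b"
      unfolding r(2)
      by (simp add: sum_distrib_left centroid_mult_left[OF Tpow] centroid_mult_right[OF Tpow])
    then have "(T ^^ i) b - (\<Sum>j<n. (T ^^ j) b * r j) \<in> Q" using b by simp
    with r(1) show "\<exists>a. (\<forall>j. a j \<in> central_closure) \<and> (T ^^ i) b - (\<Sum>j<n. (T ^^ j) b * a j) \<in> Q"
      by blast
  qed (use that in auto)
  from this[of 0] have "b \<in> Q" using n_pos by simp
  with Q b show ?thesis by (rule modular_right_ideal_UNIV)
qed

lemma nil_ring_modular_right_ideals_trivial:
  assumes nil: "\<And>a :: 's::ring. nilpotent a" and Q: "modular_right_ideal (Q :: 's set)"
  shows "Q = UNIV"
proof -
  obtain b where r: "right_ideal Q" and b: "\<And>a. a - b * a \<in> Q"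
    using Q by (auto simp: modular_right_ideal_def)
  have id: "id \<in> centroid" by (rule centroidI) simp_all
  have "\<exists>k. (id ^^ k) b \<in> Q"
    by (rule nilpotent_scalar_mod_right_ideal[OF r _ id b _ nil[of b]])
      (use r in \<open>simp_all add: right_ideal_def additive_subgroup_def\<close>)
  then obtain k where "(id ^^ k) b \<in> Q" by blast
  moreover have "(id ^^ k) b = b" by (induction k) simp_all
  ultimately have "b \<in> Q" by simp
  with r b show ?thesis by (rule modular_right_ideal_UNIV)
qed

section \<open>Images of polynomial rings\<close>

text \<open>
  Multiplication by the indeterminate, which need not be an element of the polynomial ring.
\<close>
definition shift :: "'a::ring polynomial_ring \<Rightarrow> 'a polynomial_ring" where
  "shift p = (\<Sum>i\<in>Poly_Mapping.keys p. Poly_Mapping.single (Suc i) (Poly_Mapping.lookup p i))"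

lemma lookup_shift:
  "Poly_Mapping.lookup (shift p) k = (case k of 0 \<Rightarrow> 0 | Suc j \<Rightarrow> Poly_Mapping.lookup p j)"
proof (cases k)
  case 0
  then show ?thesis by (simp add: shift_def lookup_sum lookup_single)
next
  case (Suc j)
  have "(\<Sum>i\<in>Poly_Mapping.keys p. (Poly_Mapping.lookup p i when Suc i = Suc j)) = Poly_Mapping.lookup p j"
    by (cases "j \<in> Poly_Mapping.keys p")
      (simp_all add: when_def in_keys_iff)
  with Suc show ?thesis by (simp add: shift_def lookup_sum lookup_single)
qed

lemma shift_add: "shift (p + q) = shift p + shift q"
  by (rule poly_mapping_eqI) (simp add: lookup_shift lookup_add split: nat.split)

lemma shift_single: "shift (Poly_Mapping.single i a) = Poly_Mapping.single (Suc i) a"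
  by (rule poly_mapping_eqI) (simp add: lookup_shift lookup_single when_def split: nat.split)

lemma shift_mult_left: "shift (p * q) = shift p * q"
proof (rule poly_mapping_eqI)
  fix k
  show "Poly_Mapping.lookup (shift (p * q)) k = Poly_Mapping.lookup (shift p * q) k"
  proof (cases k)
    case (Suc j)
    then show ?thesis
      by (simp add: lookup_shift lookup_times_polynomial_ring sum.atMost_Suc_shift del: sum.atMost_Suc)
  qed (simp add: lookup_shift lookup_times_polynomial_ring)
qed

lemma shift_mult_right: "shift (p * q) = p * shift q"
proof (rule poly_mapping_eqI)
  fix k
  show "Poly_Mapping.lookup (shift (p * q)) k = Poly_Mapping.lookup (p * shift q) k"
  proof (cases k)
    case (Suc j)
    have "(\<Sum>i\<le>Suc j. Poly_Mapping.lookup p i * Poly_Mapping.lookup (shift q) (Suc j - i)) =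
        (\<Sum>i\<le>j. Poly_Mapping.lookup p i * Poly_Mapping.lookup q (j - i))"
      by (simp add: lookup_shift Suc_diff_le)
    then show ?thesis by (simp add: Suc lookup_shift[of "p * q"] lookup_times_polynomial_ring)
  qed (simp add: lookup_shift lookup_times_polynomial_ring)
qed

text \<open>
  The map is well defined on the image: if \<open>f p = f q\<close>, then \<open>f (x p) - f (x q)\<close> annihilates every
  \<open>f r\<close>, since \<open>(x p) r = p (x r)\<close>.
\<close>
lemma induced_shift:
  fixes f :: "'n::ring polynomial_ring \<Rightarrow> 's::ring"
  assumes S: "simple_ring TYPE('s)" and f: "ring_homomorphism f" and surj: "surj f"
  shows "\<exists>T\<in>centroid. \<forall>p. T (f p) = f (shift p)"
proof -
  have f_add: "f (x + y) = f x + f y" and f_mult: "f (x * y) = f x * f y" for x y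
    using f by (simp_all add: ring_homomorphism_def)
  have wd: "f (shift p) = f (shift q)" if "f p = f q" for p q
  proof -
    have "(f (shift p) - f (shift q)) * s = 0" for s
    proof -
      obtain r where r: "s = f r" using surj by (metis surjD)
      have "f (shift u) * f r = f u * f (shift r)" for u
        by (metis f_mult shift_mult_left shift_mult_right)
      then show ?thesis using that by (simp add: r left_diff_distrib)
    qed
    then show ?thesis using simple_ring_left_annihilator[OF S] by fastforce
  qed
  define T where "T s = f (shift (inv f s))" for s
  have T: "T (f p) = f (shift p)" for p
    unfolding T_def by (rule wd) (simp add: surj surj_f_inv_f)
  have "T \<in> centroid"
  proof (rule centroidI)
    fix x y
    obtain p q where pq: "x = f p" "y = f q" using surj by (metis surjD)
    show "T (x + y) = T x + T y" unfolding pq by (metis T shift_add f_add)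
    show "T (x * y) = T x * y" unfolding pq by (metis T shift_mult_left f_mult)
    show "T (x * y) = x * T y" unfolding pq by (metis T shift_mult_right f_mult)
  qed
  with T show ?thesis by blast
qed

lemma ring_homomorphism_nilpotent:
  assumes f: "ring_homomorphism f" and a: "nilpotent a"
  shows "nilpotent (f a)"
proof -
  have f_add: "f (x + y) = f x + f y" and f_mult: "f (x * y) = f x * f y" for x y
    using f by (simp_all add: ring_homomorphism_def)
  have f0: "f 0 = 0" using f_add[of 0 0] by simp
  obtain k where "((*) a ^^ k) a = 0" using a by (auto simp: nilpotent_def)
  moreover have "((*) (f a) ^^ k) (f a) = f (((*) a ^^ k) a)" for k
    by (induction k) (simp_all add: f_mult)
  ultimately have "((*) (f a) ^^ k) (f a) = 0" by (simp add: f0)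
  then show ?thesis by (auto simp: nilpotent_def)
qed

theorem polynomial_image_modular_right_ideals_trivial:
  fixes f :: "'n::ring polynomial_ring \<Rightarrow> 's::ring"
  assumes nil: "nil_ring TYPE('n)" and S: "simple_ring TYPE('s)"
    and f: "ring_homomorphism f" and surj: "surj f" and Q: "modular_right_ideal (Q :: 's set)"
  shows "Q = UNIV"
proof -
  have f_add: "f (x + y) = f x + f y" and f_mult: "f (x * y) = f x * f y" for x y
    using f by (simp_all add: ring_homomorphism_def)
  have f0: "f 0 = 0" using f_add[of 0 0] by simp
  have f_minus: "f (- x) = - f x" for x
    using f_add[of x "- x"] by (simp add: f0 eq_neg_iff_add_eq_0 add.commute)
  have f_sum: "f (\<Sum>i\<in>I. h i) = (\<Sum>i\<in>I. f (h i))" for h and I :: "nat set"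
    by (induction I rule: infinite_finite_induct) (simp_all add: f0 f_add)
  define \<iota> where "\<iota> a = f (Poly_Mapping.single 0 a)" for a
  have \<iota>_hom: "ring_homomorphism \<iota>"
    unfolding ring_homomorphism_def \<iota>_def
    by (simp add: single_add f_add mult_single flip: f_mult)
  define N where "N = range \<iota>"
  have \<iota>_N: "\<iota> a \<in> N" for a by (simp add: N_def)
  have N: "additive_subgroup N"
  proof -
    have "\<iota> 0 = 0" "\<iota> (a + b) = \<iota> a + \<iota> b" "\<iota> (- a) = - \<iota> a" for a b
      by (simp_all add: \<iota>_def f0 f_add single_add single_uminus f_minus)
    then show ?thesis
      unfolding additive_subgroup_def N_def by (metis (no_types, lifting) rangeE rangeI)
  qed
  have N_mult: "a * b \<in> N" if "a \<in> N" "b \<in> N" for a b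
    using that \<iota>_hom unfolding ring_homomorphism_def N_def by (metis (no_types, lifting) rangeE rangeI)
  have N_nil: "nilpotent a" if "a \<in> N" for a
    using that ring_homomorphism_nilpotent[OF \<iota>_hom] nil by (auto simp: N_def nil_ring_def)
  obtain T where T: "T \<in> centroid" and Tf: "\<And>p. T (f p) = f (shift p)"
    using induced_shift[OF S f surj] by blast
  have single: "f (Poly_Mapping.single i a) = (T ^^ i) (\<iota> a)" for i a
    by (induction i) (simp_all add: \<iota>_def flip: shift_single Tf)
  have span: "\<exists>k. s \<in> polys T N k" for s
  proof -
    obtain p where p: "s = f p" using surj by (metis surjD)
    obtain k where k: "\<And>i. i \<in> Poly_Mapping.keys p \<Longrightarrow> i < k"
      using finite_nat_set_iff_bounded[of "Poly_Mapping.keys p"] by auto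
    have "p = (\<Sum>i<k. Poly_Mapping.single i (Poly_Mapping.lookup p i))"
    proof (rule poly_mapping_eqI)
      fix j
      show "Poly_Mapping.lookup p j =
          Poly_Mapping.lookup (\<Sum>i<k. Poly_Mapping.single i (Poly_Mapping.lookup p i)) j"
        using k[of j] by (auto simp: lookup_sum lookup_single when_def in_keys_iff)
    qed
    then have "s = (\<Sum>i<k. (T ^^ i) (\<iota> (Poly_Mapping.lookup p i)))"
      unfolding p by (metis (mono_tags, lifting) f_sum single sum.cong)
    moreover have "(\<Sum>i<k. (T ^^ i) (\<iota> (Poly_Mapping.lookup p i))) \<in> polys T N k"
      by (rule polysI) (use \<iota>_N N in \<open>auto simp: additive_subgroup_def\<close>)
    ultimately show ?thesis by blast
  qed
  show ?thesis
  proof (cases "\<exists>s. T s \<noteq> 0")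
    case True
    interpret nil_generated N T
      by unfold_locales (use S N N_mult N_nil T True span in auto)
    show ?thesis using modular_right_ideals_trivial[OF Q] .
  next
    case False
    have "nilpotent s" for s :: 's
    proof -
      obtain k where "s \<in> polys T N k" using span by blast
      then have "s \<in> polys T N (Suc k)"
        using polys_mono[OF T, of N k "Suc k"] N by (simp add: additive_subgroup_def)
      then obtain a x' where "a \<in> N" "s = a + T x'" by (rule polys_Suc_split[OF T])
      with False N_nil show ?thesis by simp
    qed
    then show ?thesis using nil_ring_modular_right_ideals_trivial Q by blast
  qed
qed

theorem corollary1:
  assumes "nil_ring TYPE('n::ring)"
    and "simple_ring TYPE('s::ring)"
    and "right_primitive_ring TYPE('s)"
  shows "\<not> (\<exists>f :: 'n polynomial_ring \<Rightarrow> 's. ring_homomorphism f \<and> surj f)"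
proof
  assume "\<exists>f :: 'n polynomial_ring \<Rightarrow> 's. ring_homomorphism f \<and> surj f"
  then obtain f :: "'n polynomial_ring \<Rightarrow> 's" where f: "ring_homomorphism f" "surj f" by blast
  obtain Q :: "'s set" where "modular_right_ideal Q" "Q \<noteq> UNIV"
    using assms(3)
    by (auto simp: right_primitive_ring_def right_primitive_ideal_def modular_maximal_right_ideal_def)
  with polynomial_image_modular_right_ideals_trivial[OF assms(1,2) f] show False by blast
qed

end
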